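(* Let $G$ be a simple mixed graph on $n$ vertices with a factorization $G=G_1\oplus G_2$. Then (i) $\boldsymbol{\nu}_{2n-1}(G)\geq\boldsymbol{\nu}_{2n-1}(G_1)+\boldsymbol{\nu}_{2n-1}(G_2)$, and (ii) $\max\{\boldsymbol{\nu}_{1}(G_1),\boldsymbol{\nu}_{1}(G_2)\}\leq\boldsymbol{\nu}_{1}(G)\leq\boldsymbol{\nu}_{1}(G_1)+\boldsymbol{\nu}_{1}(G_2)$, where $\boldsymbol{\nu}_1(\cdot)\ge\cdots\ge\boldsymbol{\nu}_{2n}(\cdot)$ denote the eigenvalues of the integrated Laplacian matrix.
   Context: A mixed graph $G$ has a finite vertex set $V_G$, a multiset $E_G$ of edges (unordered pairs) and a multiset $\vec{E}_G$ of arcs (ordered pairs); it is simple if it has no loops, directed loops, multiple edges or multiple arcs. A spanning submixed graph of $G$ has the same vertex set and sub-multisets of edges and arcs. $G$ is a factorization of spanning submixed graphs $G_1,G_2$, written $G=G_1\oplus G_2$, if $E_G=E_{G_1}\cup E_{G_2}$, $\vec{E}_G=\vec{E}_{G_1}\cup\vec{E}_{G_2}$, $E_{G_1}\cap E_{G_2}=\emptyset$ and $\vec{E}_{G_1}\cap\vec{E}_{G_2}=\emptyset$. $d(v)$ is the number of edges at $v$; $d^+(v)$ (resp. $d^-(v)$) the number of arcs starting (resp. ending) at $v$. For $V_G=\{v_1,\dots,v_n\}$, the integrated adjacency matrix $\mathcal{I}(G)$ is the $2n\times 2n$ matrix indexed by $v'_1,\dots,v'_n,v''_1,\dots,v''_n$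 whose $(v'_i,v'_j)$ and $(v''_i,v''_j)$ entries are the number of edges joining $v_i,v_j$ and whose $(v'_i,v''_j)$ and $(v''_j,v'_i)$ entries are the number of arcs from $v_i$ to $v_j$. The integrated degree matrix $\mathcal{I}^D(G)$ is diagonal with $(v'_i,v'_i)$ entry $d(v_i)+d^+(v_i)$ and $(v''_i,v''_i)$ entry $d(v_i)+d^-(v_i)$; the integrated Laplacian matrix is $\mathcal{I}^L(G)=\mathcal{I}^D(G)-\mathcal{I}(G)$. *)

theory Defs
  imports
    "HOL-Library.Multiset"
    "HOL-Library.Uprod"
    "Jordan_Normal_Form.Char_Poly"
begin

record 'a mixed_graph =
  verts :: "'a set"
  edges :: "'a uprod multiset"
  arcs :: "('a \<times> 'a) multiset"

definition mixed_graph :: "'a mixed_graph \<Rightarrow> bool" where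
  "mixed_graph G \<longleftrightarrow>
     finite (verts G) \<and>
     (\<forall>e \<in># edges G. set_uprod e \<subseteq> verts G) \<and>
     set_mset (arcs G) \<subseteq> verts G \<times> verts G"

text \<open>An edge and an arc, or two opposite arcs, may join the same two vertices of a simple
  mixed graph.\<close>

definition simple_mixed_graph :: "'a mixed_graph \<Rightarrow> bool" where
  "simple_mixed_graph G \<longleftrightarrow>
     mixed_graph G \<and>
     (\<forall>v. Upair v v \<notin># edges G) \<and>
     (\<forall>v. (v, v) \<notin># arcs G) \<and>
     (\<forall>e. count (edges G) e \<le> 1) \<and>
     (\<forall>a. count (arcs G) a \<le> 1)"

definition spanning_submixed_graph :: "'a mixed_graph \<Rightarrow> 'a mixed_graph \<Rightarrow> bool" where
  "spanning_submixed_graph H G \<longleftrightarrow>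
     mixed_graph H \<and> verts H = verts G \<and> edges H \<subseteq># edges G \<and> arcs H \<subseteq># arcs G"

definition factorization :: "'a mixed_graph \<Rightarrow> 'a mixed_graph \<Rightarrow> 'a mixed_graph \<Rightarrow> bool" where
  "factorization G G1 G2 \<longleftrightarrow>
     spanning_submixed_graph G1 G \<and> spanning_submixed_graph G2 G \<and>
     edges G = edges G1 \<union># edges G2 \<and> arcs G = arcs G1 \<union># arcs G2 \<and>
     edges G1 \<inter># edges G2 = {#} \<and> arcs G1 \<inter># arcs G2 = {#}"

text \<open>A loop would count once; how loops are counted is irrelevant for simple mixed graphs.\<close>

definition edge_degree :: "'a mixed_graph \<Rightarrow> 'a \<Rightarrow> nat" where
  "edge_degree G v = size {#e \<in># edges G. v \<in> set_uprod e#}"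

definition out_degree :: "'a mixed_graph \<Rightarrow> 'a \<Rightarrow> nat" where
  "out_degree G v = size {#a \<in># arcs G. fst a = v#}"

definition in_degree :: "'a mixed_graph \<Rightarrow> 'a \<Rightarrow> nat" where
  "in_degree G v = size {#a \<in># arcs G. snd a = v#}"

text \<open>The list \<open>vs\<close> enumerates the vertices. With \<open>n = length vs\<close>, a row or column index
  \<open>i < n\<close> stands for the primed copy of \<open>vs ! i\<close>, and \<open>n + i\<close> for its double-primed copy.\<close>

definition integrated_adjacency :: "'a list \<Rightarrow> 'a mixed_graph \<Rightarrow> real mat" where
  "integrated_adjacency vs G =
     (let n = length vs in
      mat (2 * n) (2 * n) (\<lambda>(i, j).
        if i < n \<and> j < n then real (count (edges G) (Upair (vs ! i) (vs ! j)))
        else if i < n \<and> n \<le> j then real (count (arcs G) (vs ! i, vs ! (j - n)))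
        else if n \<le> i \<and> j < n then real (count (arcs G) (vs ! j, vs ! (i - n)))
        else real (count (edges G) (Upair (vs ! (i - n)) (vs ! (j - n))))))"

definition integrated_degree :: "'a list \<Rightarrow> 'a mixed_graph \<Rightarrow> real mat" where
  "integrated_degree vs G =
     (let n = length vs in
      mat (2 * n) (2 * n) (\<lambda>(i, j).
        if i \<noteq> j then 0
        else if i < n then real (edge_degree G (vs ! i) + out_degree G (vs ! i))
        else real (edge_degree G (vs ! (i - n)) + in_degree G (vs ! (i - n)))))"

definition integrated_laplacian :: "'a list \<Rightarrow> 'a mixed_graph \<Rightarrow> real mat" where
  "integrated_laplacian vs G = integrated_degree vs G - integrated_adjacency vs G"

text \<open>Eigenvalues are listed in decreasing order with algebraic multiplicity, as the real roots of
  the characteristic polynomial. For a symmetric real matrix these are all its eigenvalues, so the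
  list is as long as the matrix dimension.\<close>

definition eigenvalue_list :: "real mat \<Rightarrow> real list" where
  "eigenvalue_list A = rev (sorted_list_of_multiset (proots (char_poly A)))"

text \<open>The index \<open>k\<close> counts from 1.\<close>

definition laplacian_ev :: "'a list \<Rightarrow> nat \<Rightarrow> 'a mixed_graph \<Rightarrow> real" where
  "laplacian_ev vs k G = eigenvalue_list (integrated_laplacian vs G) ! (k - 1)"

end

theory Submission
  imports Defs "Jordan_Normal_Form.Schur_Decomposition"
begin

text \<open>
  The integrated adjacency matrix is a symmetric nonnegative matrix whose row sums are the integrated
  degrees, so the integrated Laplacian \<open>L\<close> satisfies
  \<open>2 (x \<bullet> L x) = (\<Sum>i j. a\<^sub>i\<^sub>j (x\<^sub>i - x\<^sub>j)\<^sup>2)\<close>: it is positive semidefinite and annihilates the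
  all-ones vector \<open>w\<close>. A factorization gives \<open>L(G) = L(G1) + L(G2)\<close>. The bounds on the largest
  eigenvalue follow because it is the maximum of the Rayleigh quotient. For the second smallest
  eigenvalue, a combination \<open>x\<close> of the last two eigenvectors of \<open>L(G)\<close> is orthogonal to \<open>w\<close>, and on
  the orthogonal complement of \<open>w\<close> the quadratic forms of \<open>L(G1)\<close> and \<open>L(G2)\<close> are bounded below by
  their second smallest eigenvalues.
\<close>

subsection \<open>The spectral theorem for real symmetric matrices\<close>

lemma conjugate_real_vec [simp]: "conjugate (v :: real vec) = v"
  by (rule eq_vecI) auto

lemma mult_mat_vec_index_sum:
  assumes "A \<in> carrier_mat n n" "x \<in> carrier_vec n" "i < n"
  shows "(A *\<^sub>v x) $ i = (\<Sum>j<n. A $$ (i, j) * x $ j)"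
  using assms by (auto simp: scalar_prod_def lessThan_atLeast0 intro!: sum.cong)

text \<open>The product here is bilinear, without conjugation. The general scalar type allows an
  application to a real symmetric matrix read over the complex numbers.\<close>

lemma mult_symmetric_vec_comm:
  fixes A :: "'a :: comm_semiring_0 mat"
  assumes "A \<in> carrier_mat n n" "transpose_mat A = A"
    and "x \<in> carrier_vec n" "y \<in> carrier_vec n"
  shows "(A *\<^sub>v x) \<bullet> y = x \<bullet> (A *\<^sub>v y)"
  by (metis assms transpose_vec_mult_scalar comm_scalar_prod mult_mat_vec_carrier)

text \<open>For an eigenvector \<open>v\<close> of \<open>z\<close>, moving the matrix across
  \<open>v \<bullet> conjugate v\<close> yields both \<open>z\<close> and \<open>cnj z\<close> as
  factors of the same nonzero number.\<close>

lemma symmetric_complex_root_real: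
  fixes A :: "real mat"
  assumes A: "A \<in> carrier_mat n n" and sym: "transpose_mat A = A"
    and root: "poly (char_poly (map_mat complex_of_real A)) z = 0"
  shows "z \<in> \<real>"
proof -
  let ?C = "map_mat complex_of_real A"
  have C: "?C \<in> carrier_mat n n" using A by simp
  have symC: "transpose_mat ?C = ?C" using sym by (metis map_mat_transpose)
  obtain v where v: "v \<in> carrier_vec n" "v \<noteq> 0\<^sub>v n" "?C *\<^sub>v v = z \<cdot>\<^sub>v v"
    using root eigenvalue_root_char_poly[OF C, of z] A
    unfolding eigenvalue_def eigenvector_def by auto
  have cv: "conjugate v \<in> carrier_vec n" using v by simp
  \<comment> \<open>The entries of \<open>?C\<close> are real, so the eigenvector equation can be
    conjugated entrywise.\<close>
  have Ccv: "?C *\<^sub>v conjugate v = cnj z \<cdot>\<^sub>v conjugate v"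
  proof (rule eq_vecI)
    fix i assume "i < dim_vec (cnj z \<cdot>\<^sub>v conjugate v)"
    then have i: "i < n" using v by simp
    have "(?C *\<^sub>v conjugate v) $ i = cnj ((?C *\<^sub>v v) $ i)"
      unfolding mult_mat_vec_index_sum[OF C cv i] mult_mat_vec_index_sum[OF C v(1) i]
      using A v(1) i by simp
    then show "(?C *\<^sub>v conjugate v) $ i = (cnj z \<cdot>\<^sub>v conjugate v) $ i"
      using v i by simp
  qed (use A v in auto)
  have "z * (v \<bullet> conjugate v) = (?C *\<^sub>v v) \<bullet> conjugate v"
    unfolding v(3) using v(1) cv by simp
  also have "\<dots> = v \<bullet> (?C *\<^sub>v conjugate v)"
    by (rule mult_symmetric_vec_comm[OF C symC v(1) cv])
  also have "\<dots> = cnj z * (v \<bullet> conjugate v)" unfolding Ccv using v(1) cv by simp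
  finally have "z = cnj z" using v(2) conjugate_square_eq_0_vec[OF v(1)] by auto
  then show ?thesis using Reals_cnj_iff by metis
qed

text \<open>The polynomial splits over the complex numbers, all its roots are real, and the
  factorization pulls back along the injective embedding of the reals.\<close>

lemma char_poly_symmetric_splits:
  fixes A :: "real mat"
  assumes A: "A \<in> carrier_mat n n" and sym: "transpose_mat A = A"
  shows "char_poly A = (\<Prod>e\<leftarrow>eigenvalue_list A. [:- e, 1:])"
proof -
  interpret P: map_poly_comm_ring_hom complex_of_real ..
  let ?C = "map_mat complex_of_real A"
  have C: "?C \<in> carrier_mat n n" using A by simp
  obtain zs where zs: "char_poly ?C = (\<Prod>z\<leftarrow>zs. [:- z, 1:])"
    using char_poly_factorized[OF C] by auto
  have real: "z \<in> \<real>" if "z \<in> set zs" for z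
    by (rule symmetric_complex_root_real[OF A sym])
      (use that in \<open>auto simp: zs poly_prod_list prod_list_zero_iff\<close>)
  define es where "es = map Re zs"
  have zs_es: "zs = map complex_of_real es"
    unfolding es_def using real by (auto simp: map_idI)
  have "map_poly complex_of_real (char_poly A) = char_poly ?C"
    by (simp add: of_real_hom.char_poly_hom[OF A])
  also have "\<dots> = map_poly complex_of_real (\<Prod>e\<leftarrow>es. [:- e, 1:])"
    unfolding zs zs_es by (induction es) (simp_all add: P.hom_mult del: mult_pCons_left)
  finally have es: "char_poly A = (\<Prod>e\<leftarrow>es. [:- e, 1:])"
    by (simp add: poly_eq_iff coeff_map_poly)
  \<comment> \<open>The root multiset of a product of linear factors is the multiset of its roots;
    sorting it therefore only permutes the factors.\<close>
  have "proots (\<Prod>e\<leftarrow>es. [:- e, 1:]) = mset es" for es :: "real list"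
  proof (induction es)
    case (Cons e es)
    have "(\<Prod>e\<leftarrow>es. [:- e, 1:]) \<noteq> 0" by (auto simp: prod_list_zero_iff)
    then have "proots ([:- e, 1:] * (\<Prod>e\<leftarrow>es. [:- e, 1:])) =
        proots [:- e, 1:] + proots (\<Prod>e\<leftarrow>es. [:- e, 1:])"
      by (intro proots_mult) auto
    with Cons show ?case by (simp del: mult_pCons_left)
  qed simp
  then have "mset (eigenvalue_list A) = mset es"
    by (simp add: eigenvalue_list_def es)
  then show ?thesis unfolding es
    by (metis mset_map prod_mset_prod_list)
qed

text \<open>Comparing degrees shows that no root is lost, so \<open>!\<close> is meaningful at every
  index below \<open>n\<close>.\<close>

lemma length_eigenvalue_list:
  fixes A :: "real mat"
  assumes A: "A \<in> carrier_mat n n" and sym: "transpose_mat A = A"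
  shows "length (eigenvalue_list A) = n"
proof -
  have "degree (\<Prod>e\<leftarrow>es. [:- e, 1:]) = length es" for es :: "real list"
    by (rule degree_linear_factors)
  then show ?thesis
    using degree_monic_char_poly[OF A] char_poly_symmetric_splits[OF A sym] by metis
qed

lemma eigenvalue_list_antimono:
  assumes "i \<le> j" "j < length (eigenvalue_list A)"
  shows "eigenvalue_list A ! j \<le> eigenvalue_list A ! i"
  using assms by (auto simp: eigenvalue_list_def rev_nth intro!: sorted_nth_mono)

text \<open>Two distinct unit vectors are exchanged by the reflection in the hyperplane orthogonal
  to their difference. This gives a symmetric orthogonal matrix that moves a unit eigenvector to the
  first axis.\<close>

lemma householder_reflection:
  fixes v :: "real vec"
  assumes v: "v \<in> carrier_vec n" "v \<bullet> v = 1" and n: "0 < n"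
  obtains H where "H \<in> carrier_mat n n" "transpose_mat H = H" "H * H = 1\<^sub>m n"
    "H *\<^sub>v v = unit_vec n 0" "H *\<^sub>v unit_vec n 0 = v"
proof (cases "v = unit_vec n 0")
  case True
  show ?thesis by (rule that[of "1\<^sub>m n"]) (use True in auto)
next
  case False
  let ?e = "unit_vec n 0 :: real vec"
  define w where "w = v - ?e"
  \<comment> \<open>With this factor \<open>H\<close> is the identity minus \<open>c\<close> times
    the outer product of \<open>w\<close> with itself, the reflection that negates
    \<open>w\<close>.\<close>
  define c where "c = 2 / (w \<bullet> w)"
  define H where "H = mat n n (\<lambda>(i, j). (if i = j then 1 else 0) - c * (w $ i * w $ j))"
  have w: "w \<in> carrier_vec n" unfolding w_def using v by simp
  have "w \<noteq> 0\<^sub>v n"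
  proof
    assume "w = 0\<^sub>v n"
    then have "w $ i = 0" if "i < n" for i using that by simp
    then have "v = ?e" using v n by (intro eq_vecI) (auto simp: w_def)
    with False show False by simp
  qed
  then have ww: "w \<bullet> w \<noteq> 0" using conjugate_square_eq_0_vec[OF w] by simp
  have ww_sum: "(\<Sum>k<n. w $ k * w $ k) = w \<bullet> w"
    using w by (simp add: scalar_prod_def lessThan_atLeast0)
  have H: "H \<in> carrier_mat n n" unfolding H_def by simp
  have H_mult: "H *\<^sub>v x = x - (c * (w \<bullet> x)) \<cdot>\<^sub>v w" if x: "x \<in> carrier_vec n" for x
  proof (rule eq_vecI)
    fix i assume "i < dim_vec (x - (c * (w \<bullet> x)) \<cdot>\<^sub>v w)"
    then have i: "i < n" using w x by simp
    have "(H *\<^sub>v x) $ i = (\<Sum>j<n. ((if i = j then 1 else 0) - c * (w $ i * w $ j)) * x $ j)"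
      unfolding mult_mat_vec_index_sum[OF H x i] using i by (auto simp: H_def)
    also have "\<dots> = (\<Sum>j<n. (if i = j then x $ j else 0) - (c * w $ i) * (w $ j * x $ j))"
      by (intro sum.cong) (auto simp: algebra_simps)
    also have "\<dots> = x $ i - (c * w $ i) * (\<Sum>j<n. w $ j * x $ j)"
      using i by (simp add: sum_subtractf sum_distrib_left)
    finally show "(H *\<^sub>v x) $ i = (x - (c * (w \<bullet> x)) \<cdot>\<^sub>v w) $ i"
      using i w x by (simp add: scalar_prod_def lessThan_atLeast0 algebra_simps)
  qed (use H w that in auto)
  have HH: "H * H = 1\<^sub>m n"
  proof (rule eq_matI)
    fix i j assume "i < dim_row (1\<^sub>m n :: real mat)" "j < dim_col (1\<^sub>m n :: real mat)"
    then have ij: "i < n" "j < n" by auto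
    have colj: "col H j $ k = (if k = j then 1 else 0) - c * (w $ k * w $ j)" if "k < n" for k
      using that ij by (simp add: H_def)
    \<comment> \<open>The normalization \<open>c * (w \<bullet> w) = 2\<close> will turn this value
      into \<open>- w $ j\<close>, which says that \<open>H\<close> sends \<open>w\<close> to its
      negative.\<close>
    have "w \<bullet> col H j = w $ j - c * w $ j * (\<Sum>k<n. w $ k * w $ k)"
    proof -
      have "w \<bullet> col H j = (\<Sum>k<n. w $ k * ((if k = j then 1 else 0) - c * (w $ k * w $ j)))"
        unfolding scalar_prod_def using H colj by (auto simp: lessThan_atLeast0 intro!: sum.cong)
      also have "\<dots> = (\<Sum>k<n. (if k = j then w $ k else 0) - c * w $ j * (w $ k * w $ k))"
        by (intro sum.cong) (auto simp: algebra_simps)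
      finally show ?thesis using ij by (simp add: sum_subtractf sum_distrib_left)
    qed
    then have "w \<bullet> col H j = - w $ j" using ww by (simp add: ww_sum c_def)
    then have "(H *\<^sub>v col H j) $ i = (if i = j then 1 else 0)"
      using ij H w H_mult[of "col H j"] colj[of i] by simp
    moreover have "(H * H) $$ (i, j) = (H *\<^sub>v col H j) $ i" using H ij by simp
    ultimately show "(H * H) $$ (i, j) = 1\<^sub>m n $$ (i, j)" using ij by simp
  qed (use H in auto)
  \<comment> \<open>Both vectors have length 1, so \<open>w \<bullet> w\<close> is twice
    \<open>w \<bullet> v\<close>. Hence \<open>c * (w \<bullet> v) = 1\<close>, and \<open>H\<close>
    takes \<open>v\<close> to \<open>v - w\<close>, the first unit vector.\<close>
  have ee: "?e \<bullet> ?e = 1" "?e \<bullet> v = v $ 0" "v \<bullet> ?e = v $ 0" using n v by auto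
  have "w \<bullet> v = 1 - v $ 0" unfolding w_def
    using v n ee by (simp add: minus_scalar_prod_distrib[of _ n])
  moreover have "w \<bullet> w = 2 * (1 - v $ 0)"
    unfolding w_def using v n ee
    by (simp add: minus_scalar_prod_distrib[of _ n] scalar_prod_minus_distrib[of _ n])
  ultimately have "c * (w \<bullet> v) = 1" using ww by (simp add: c_def)
  then have Hv: "H *\<^sub>v v = ?e"
    unfolding H_mult[OF v(1)] using v by (auto simp: w_def)
  have "H *\<^sub>v ?e = (H * H) *\<^sub>v v" using H v by (simp add: Hv[symmetric] assoc_mult_mat_vec[of _ n n])
  then have "H *\<^sub>v ?e = v" using HH v by simp
  moreover have "transpose_mat H = H" by (rule eq_matI) (auto simp: H_def)
  ultimately show ?thesis using that H HH Hv by blast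
qed

text \<open>The order of \<open>es\<close> is arbitrary, so that the columns of \<open>P\<close> can be matched with the sorted
  eigenvalues.\<close>

theorem spectral_theorem:
  fixes A :: "real mat"
  assumes "A \<in> carrier_mat n n" "transpose_mat A = A"
    and "char_poly A = (\<Prod>e\<leftarrow>es. [:- e, 1:])"
  shows "\<exists>P. similar_mat_wit A (mat_diag n (\<lambda>i. es ! i)) P (transpose_mat P)"
  using assms
proof (induction es arbitrary: n A)
  case Nil
  then have "n = 0" using degree_monic_char_poly[OF Nil.prems(1)] by simp
  with Nil.prems(1) have "A = mat_diag n (\<lambda>i. [] ! i)" by (intro eq_matI) (auto simp: mat_diag_def)
  then have "similar_mat_wit A (mat_diag n (\<lambda>i. [] ! i)) (1\<^sub>m n) (transpose_mat (1\<^sub>m n))"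
    using similar_mat_wit_refl[OF Nil.prems(1)] by simp
  then show ?case by blast
next
  case (Cons e es)
  note A = Cons.prems(1) and sym = Cons.prems(2)
  define m where "m = n - 1"
  have ev: "eigenvalue A e"
    unfolding eigenvalue_root_char_poly[OF A] Cons.prems(3) by simp
  then have n: "0 < n" by (rule eigenvalue_imp_nonzero_dim[OF A])
  then have nm: "n = 1 + m" by (simp add: m_def)
  obtain u where u: "u \<in> carrier_vec n" "u \<noteq> 0\<^sub>v n" "A *\<^sub>v u = e \<cdot>\<^sub>v u"
    using ev A unfolding eigenvalue_def eigenvector_def by auto
  have uu: "u \<bullet> u > 0"
    using conjugate_square_greater_0_vec[OF u(1)] u(2) by simp
  define v where "v = (1 / sqrt (u \<bullet> u)) \<cdot>\<^sub>v u"
  have v: "v \<in> carrier_vec n" "v \<bullet> v = 1" "A *\<^sub>v v = e \<cdot>\<^sub>v v"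
    using u uu A unfolding v_def
    by (auto simp: mult_mat_vec[OF A u(1)] smult_smult_assoc mult.commute divide_simps)
  obtain H where H: "H \<in> carrier_mat n n" "transpose_mat H = H" "H * H = 1\<^sub>m n"
    "H *\<^sub>v v = unit_vec n 0" "H *\<^sub>v unit_vec n 0 = v"
    using householder_reflection[OF v(1,2) n] by blast
  \<comment> \<open>Conjugation by \<open>H\<close> carries the eigenvector \<open>v\<close> to the
    first axis. The first column of \<open>B\<close> is then \<open>e\<close> followed by zeros, and
    symmetry clears the first row as well.\<close>
  define B where "B = H * A * H"
  have B: "B \<in> carrier_mat n n" unfolding B_def using H A by simp
  have symB: "transpose_mat B = B"
    unfolding B_def using H A sym by (simp add: transpose_mult[of _ n n _ n] assoc_mult_mat[of _ n n _ n _ n])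
  have "A = H * B * H"
  proof -
    have "H * B * H = (H * H) * A * (H * H)"
      unfolding B_def using H(1) A by (simp add: assoc_mult_mat[of _ n n _ n _ n])
    then show ?thesis using H A by simp
  qed
  then have simAB: "similar_mat_wit A B H H"
    by (intro similar_mat_witI[OF H(3) H(3) _ A B H(1) H(1)])
  have "B *\<^sub>v unit_vec n 0 = H *\<^sub>v (A *\<^sub>v (H *\<^sub>v unit_vec n 0))"
    unfolding B_def using H(1) A by (simp add: assoc_mult_mat_vec[of _ n n _ n])
  also have "\<dots> = e \<cdot>\<^sub>v unit_vec n 0"
    using H v by (simp add: mult_mat_vec[of H n n])
  finally have Be: "B *\<^sub>v unit_vec n 0 = e \<cdot>\<^sub>v unit_vec n 0" .
  have B0: "B $$ (i, 0) = (if i = 0 then e else 0)" if i: "i < n" for i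
  proof -
    have "(B *\<^sub>v unit_vec n 0) $ i = (\<Sum>j<n. B $$ (i, j) * unit_vec n 0 $ j)"
      by (rule mult_mat_vec_index_sum[OF B unit_vec_carrier i])
    also have "\<dots> = (\<Sum>j<n. if j = 0 then B $$ (i, j) else 0)"
      by (rule sum.cong) auto
    finally show ?thesis using i n by (auto simp: Be split: if_splits)
  qed
  have B0': "B $$ (0, i) = (if i = 0 then e else 0)" if "i < n" for i
    using that B n B0[OF that] symB by (metis carrier_matD index_transpose_mat(1))
  define C where "C = mat m m (\<lambda>(i, j). B $$ (Suc i, Suc j))"
  define D1 where "D1 = mat 1 1 (\<lambda>_. e)"
  have C: "C \<in> carrier_mat m m" and D1: "D1 \<in> carrier_mat 1 1" unfolding C_def D1_def by auto
  have Bblock: "B = four_block_mat D1 (0\<^sub>m 1 m) (0\<^sub>m m 1) C"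
    by (rule eq_matI) (use B nm B0 B0' in \<open>auto simp: C_def D1_def\<close>)
  have symC: "transpose_mat C = C"
  proof (rule eq_matI)
    fix i j assume "i < dim_row C" "j < dim_col C"
    then have "i < m" "j < m" using C by auto
    moreover from this have "B $$ (Suc j, Suc i) = B $$ (Suc i, Suc j)"
      using symB B nm by (metis carrier_matD index_transpose_mat(1) add.commute Suc_eq_plus1 Suc_less_eq)
    ultimately show "transpose_mat C $$ (i, j) = C $$ (i, j)" by (simp add: C_def)
  qed (use C in auto)
  \<comment> \<open>Since \<open>B\<close> is block diagonal, cancelling the factor of
    \<open>e\<close> leaves exactly the remaining list as the roots of \<open>C\<close>, as the
    induction hypothesis requires.\<close>
  have "char_poly A = char_poly B"
    using simAB char_poly_similar similar_mat_def by blast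
  also have "\<dots> = char_poly D1 * char_poly C"
    unfolding Bblock by (rule char_poly_four_block_zeros_col[OF D1 _ C]) simp
  also have "char_poly D1 = [:- e, 1:]"
    by (simp add: D1_def char_poly_defs det_def sign_def)
  finally have "[:- e, 1:] * char_poly C = [:- e, 1:] * (\<Prod>e\<leftarrow>es. [:- e, 1:])"
    using Cons.prems(3) by simp
  then have "char_poly C = (\<Prod>e\<leftarrow>es. [:- e, 1:])"
    by (metis mult_cancel_left pCons_eq_0_iff zero_neq_one)
  then obtain P where P: "similar_mat_wit C (mat_diag m (\<lambda>i. es ! i)) P (transpose_mat P)"
    using Cons.IH[OF C symC] by blast
  have Pc: "P \<in> carrier_mat m m" using similar_mat_witD2[OF C P] by simp
  \<comment> \<open>Bordering \<open>P\<close> with a 1 keeps its transpose as inverse, and so does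
    multiplication by the symmetric involution \<open>H\<close>.\<close>
  let ?P = "four_block_mat (1\<^sub>m 1) (0\<^sub>m 1 m) (0\<^sub>m m 1) P"
  have "similar_mat_wit B (four_block_mat D1 (0\<^sub>m 1 m) (0\<^sub>m m 1) (mat_diag m (\<lambda>i. es ! i)))
     ?P (four_block_mat (1\<^sub>m 1) (0\<^sub>m 1 m) (0\<^sub>m m 1) (transpose_mat P))"
    unfolding Bblock
    by (rule similar_mat_wit_four_block[OF similar_mat_wit_refl[OF D1] P _ _ D1 C])
      (use Pc in auto)
  also have "four_block_mat D1 (0\<^sub>m 1 m) (0\<^sub>m m 1) (mat_diag m (\<lambda>i. es ! i)) =
      mat_diag n (\<lambda>i. (e # es) ! i)"
    by (rule eq_matI) (auto simp: nm D1_def mat_diag_def)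
  also have "four_block_mat (1\<^sub>m 1) (0\<^sub>m 1 m) (0\<^sub>m m 1) (transpose_mat P) = transpose_mat ?P"
    using Pc by (subst transpose_four_block_mat[of _ 1 1 _ m _ m]) auto
  finally have "similar_mat_wit A (mat_diag n (\<lambda>i. (e # es) ! i)) (H * ?P) (transpose_mat ?P * H)"
    using similar_mat_wit_trans[OF simAB] by blast
  also have "transpose_mat ?P * H = transpose_mat (H * ?P)"
    using H Pc nm by (subst transpose_mult[of _ n n _ n]) auto
  finally show ?case by blast
qed

subsection \<open>Rayleigh quotients\<close>

text \<open>\<open>Q *\<^sub>v x\<close> is the coordinate vector of \<open>x\<close> in an
  orthonormal eigenbasis, and \<open>P\<close> turns coordinates back into vectors. The last two
  assumptions are Parseval's identity and the diagonal action of \<open>A\<close>, with eigenvalues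
  in decreasing order.\<close>

locale orthonormal_eigenbasis =
  fixes n :: nat and A P Q :: "real mat"
  assumes P_carrier: "P \<in> carrier_mat n n" and Q_carrier: "Q \<in> carrier_mat n n"
    and coords_inverse: "y \<in> carrier_vec n \<Longrightarrow> Q *\<^sub>v (P *\<^sub>v y) = y"
    and scalar_prod_coords: "x \<in> carrier_vec n \<Longrightarrow> z \<in> carrier_vec n \<Longrightarrow>
       x \<bullet> z = (\<Sum>i<n. (Q *\<^sub>v x) $ i * (Q *\<^sub>v z) $ i)"
    and coords_mult_vec: "x \<in> carrier_vec n \<Longrightarrow> i < n \<Longrightarrow>
       (Q *\<^sub>v (A *\<^sub>v x)) $ i = eigenvalue_list A ! i * (Q *\<^sub>v x) $ i"

text \<open>The spectral theorem is applied to the sorted list, so coordinate \<open>i\<close>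
  belongs to entry \<open>i\<close> of \<open>eigenvalue_list A\<close>.\<close>

lemma orthonormal_eigenbasis_exists:
  fixes A :: "real mat"
  assumes A: "A \<in> carrier_mat n n" and sym: "transpose_mat A = A"
  obtains P Q where "orthonormal_eigenbasis n A P Q"
proof -
  define es where "es = eigenvalue_list A"
  let ?D = "mat_diag n (\<lambda>i. es ! i)"
  obtain P where "similar_mat_wit A ?D P (transpose_mat P)"
    using spectral_theorem[OF A sym char_poly_symmetric_splits[OF A sym]] unfolding es_def by blast
  note P = similar_mat_witD2[OF A this]
  define Q where "Q = transpose_mat P"
  have PQ: "P \<in> carrier_mat n n" "Q \<in> carrier_mat n n" "P * Q = 1\<^sub>m n" "Q * P = 1\<^sub>m n"
    and A_eq: "A = P * ?D * Q"
    using P(1-3,6) unfolding Q_def by (simp_all add: P(4-))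
  have QP_vec: "Q *\<^sub>v (P *\<^sub>v y) = y" if "y \<in> carrier_vec n" for y
    using that PQ by (simp flip: assoc_mult_mat_vec[of Q n n P n])
  show ?thesis
  proof (rule that, unfold_locales, rule PQ(1), rule PQ(2), erule QP_vec)
    fix x z :: "real vec" assume x: "x \<in> carrier_vec n" and z: "z \<in> carrier_vec n"
    have "x \<bullet> z = (P *\<^sub>v (Q *\<^sub>v x)) \<bullet> z"
      using x PQ by (simp flip: assoc_mult_mat_vec[of P n n Q n])
    also have "\<dots> = (Q *\<^sub>v x) \<bullet> (Q *\<^sub>v z)"
      using x z PQ(1,2) transpose_vec_mult_scalar[of P n n "Q *\<^sub>v x" z]
      by (simp add: Q_def) (metis comm_scalar_prod mult_mat_vec_carrier transpose_carrier_mat)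
    finally show "x \<bullet> z = (\<Sum>i<n. (Q *\<^sub>v x) $ i * (Q *\<^sub>v z) $ i)"
      using z PQ(2) by (simp add: scalar_prod_def lessThan_atLeast0)
  next
    fix x :: "real vec" and i assume x: "x \<in> carrier_vec n" and i: "i < n"
    have Qx: "Q *\<^sub>v x \<in> carrier_vec n" using x PQ(2) by simp
    have Dy: "?D *\<^sub>v (Q *\<^sub>v x) \<in> carrier_vec n" by (rule mult_mat_vec_carrier[OF mat_diag_dim Qx])
    have "A *\<^sub>v x = P *\<^sub>v (?D *\<^sub>v (Q *\<^sub>v x))"
      unfolding A_eq using x PQ(1,2) Qx by (simp add: assoc_mult_mat_vec[of _ n n _ n])
    then have "(Q *\<^sub>v (A *\<^sub>v x)) $ i = (?D *\<^sub>v (Q *\<^sub>v x)) $ i"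
      using QP_vec[OF Dy] by simp
    also have "\<dots> = (\<Sum>j<n. if j = i then es ! j * (Q *\<^sub>v x) $ j else 0)"
      unfolding mult_mat_vec_index_sum[OF mat_diag_dim Qx i]
      by (rule sum.cong) (use i in \<open>auto simp: mat_diag_def\<close>)
    finally show "(Q *\<^sub>v (A *\<^sub>v x)) $ i = eigenvalue_list A ! i * (Q *\<^sub>v x) $ i"
      using i by (simp add: es_def)
  qed
qed

text \<open>In eigencoordinates the form is a sum of squares weighted by the eigenvalues, each at
  most the one at index 0.\<close>

lemma rayleigh_le_largest_eigenvalue:
  fixes A :: "real mat"
  assumes A: "A \<in> carrier_mat n n" and sym: "transpose_mat A = A" and x: "x \<in> carrier_vec n"
  shows "x \<bullet> (A *\<^sub>v x) \<le> eigenvalue_list A ! 0 * (x \<bullet> x)"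
proof -
  obtain P Q where "orthonormal_eigenbasis n A P Q"
    by (rule orthonormal_eigenbasis_exists[OF A sym])
  then interpret orthonormal_eigenbasis n A P Q .
  have "x \<bullet> (A *\<^sub>v x) = (\<Sum>i<n. eigenvalue_list A ! i * ((Q *\<^sub>v x) $ i)\<^sup>2)"
    using A x by (simp add: scalar_prod_coords coords_mult_vec power2_eq_square mult_ac)
  also have "\<dots> \<le> (\<Sum>i<n. eigenvalue_list A ! 0 * ((Q *\<^sub>v x) $ i)\<^sup>2)"
    by (intro sum_mono mult_right_mono eigenvalue_list_antimono)
      (auto simp: length_eigenvalue_list[OF A sym])
  finally show ?thesis
    using x by (simp add: scalar_prod_coords power2_eq_square sum_distrib_left)
qed

text \<open>The witness is the unit eigenvector whose coordinates form the first unit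
  vector.\<close>

lemma largest_eigenvalue_attained:
  fixes A :: "real mat"
  assumes A: "A \<in> carrier_mat n n" and sym: "transpose_mat A = A" and n: "0 < n"
  obtains x where "x \<in> carrier_vec n" "x \<bullet> x = 1" "x \<bullet> (A *\<^sub>v x) = eigenvalue_list A ! 0"
proof -
  obtain P Q where "orthonormal_eigenbasis n A P Q"
    by (rule orthonormal_eigenbasis_exists[OF A sym])
  then interpret orthonormal_eigenbasis n A P Q .
  define x where "x = P *\<^sub>v unit_vec n 0"
  have x: "x \<in> carrier_vec n" and Qx: "Q *\<^sub>v x = unit_vec n 0"
    unfolding x_def using P_carrier coords_inverse by auto
  have delta: "(\<Sum>i<n. f i * (unit_vec n 0 $ i * unit_vec n 0 $ i)) = f 0" for f :: "nat \<Rightarrow> real"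
  proof -
    have "(\<Sum>i<n. f i * (unit_vec n 0 $ i * unit_vec n 0 $ i)) = (\<Sum>i<n. if i = 0 then f i else 0)"
      by (rule sum.cong) auto
    then show ?thesis using n by simp
  qed
  have "x \<bullet> x = 1"
    using delta[of "\<lambda>_. 1"] by (simp add: scalar_prod_coords[OF x x] Qx)
  moreover have "x \<bullet> (A *\<^sub>v x) = eigenvalue_list A ! 0"
    using delta[of "\<lambda>i. eigenvalue_list A ! i"] A x by (simp add: scalar_prod_coords coords_mult_vec Qx mult_ac)
  ultimately show ?thesis using that x by blast
qed

text \<open>Index \<open>k\<close> counts from 0, so it is the last but one of
  \<open>n = k + 2\<close> eigenvalues. If that eigenvalue is positive, the kernel vector
  \<open>w\<close> must span the last eigendirection, and \<open>x\<close> has no component there;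
  otherwise semidefiniteness suffices.\<close>

lemma second_smallest_eigenvalue_le_rayleigh:
  fixes A :: "real mat"
  assumes A: "A \<in> carrier_mat n n" and sym: "transpose_mat A = A" and n: "n = Suc (Suc k)"
    and psd: "\<And>x. x \<in> carrier_vec n \<Longrightarrow> 0 \<le> x \<bullet> (A *\<^sub>v x)"
    and w: "w \<in> carrier_vec n" "w \<bullet> w \<noteq> 0" "A *\<^sub>v w = 0\<^sub>v n"
    and x: "x \<in> carrier_vec n" "x \<bullet> w = 0"
  shows "eigenvalue_list A ! k * (x \<bullet> x) \<le> x \<bullet> (A *\<^sub>v x)"
proof (cases "eigenvalue_list A ! k \<le> 0")
  case True
  have "0 \<le> x \<bullet> x" by (simp add: scalar_prod_def sum_nonneg)
  with True have "eigenvalue_list A ! k * (x \<bullet> x) \<le> 0" by (rule mult_nonpos_nonneg)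
  then show ?thesis using psd[OF x(1)] by linarith
next
  case False
  let ?e = "\<lambda>i. eigenvalue_list A ! i"
  obtain P Q where "orthonormal_eigenbasis n A P Q"
    by (rule orthonormal_eigenbasis_exists[OF A sym])
  then interpret orthonormal_eigenbasis n A P Q .
  have mono: "?e k \<le> ?e i" if "i \<le> k" for i
    using that n by (intro eigenvalue_list_antimono) (auto simp: length_eigenvalue_list[OF A sym])
  \<comment> \<open>\<open>A\<close> annihilates \<open>w\<close>, while the eigenvalues up to index
    \<open>k\<close> are positive.\<close>
  have Qw: "(Q *\<^sub>v w) $ i = 0" if "i \<le> k" for i
  proof -
    have "?e i * (Q *\<^sub>v w) $ i = (Q *\<^sub>v (A *\<^sub>v w)) $ i" using coords_mult_vec[OF w(1)] that n by simp
    also have "\<dots> = 0" using Q_carrier that n by (simp add: w(3) scalar_prod_def)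
    finally show ?thesis using mono[OF that] False by auto
  qed
  have sum_eq: "z \<bullet> w = (Q *\<^sub>v z) $ Suc k * (Q *\<^sub>v w) $ Suc k" if "z \<in> carrier_vec n" for z
    unfolding scalar_prod_coords[OF that w(1)] unfolding n by (simp add: Qw)
  \<comment> \<open>Taking \<open>z = w\<close> shows that the last coordinate of \<open>w\<close>
    is nonzero; taking \<open>z = x\<close> then forces that of \<open>x\<close> to vanish.\<close>
  have Qx: "(Q *\<^sub>v x) $ Suc k = 0"
    using sum_eq[OF w(1)] sum_eq[OF x(1)] w(2) x(2) by auto
  have "?e k * (x \<bullet> x) = (\<Sum>i<n. ?e k * ((Q *\<^sub>v x) $ i)\<^sup>2)"
    using x by (simp add: scalar_prod_coords power2_eq_square sum_distrib_left)
  also have "\<dots> \<le> (\<Sum>i<n. ?e i * ((Q *\<^sub>v x) $ i)\<^sup>2)"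
  proof (rule sum_mono)
    fix i assume "i \<in> {..<n}"
    then consider "i \<le> k" | "i = Suc k" unfolding n by fastforce
    then show "?e k * ((Q *\<^sub>v x) $ i)\<^sup>2 \<le> ?e i * ((Q *\<^sub>v x) $ i)\<^sup>2"
      by cases (auto simp: Qx intro!: mult_right_mono mono)
  qed
  also have "\<dots> = x \<bullet> (A *\<^sub>v x)"
    using A x by (simp add: scalar_prod_coords coords_mult_vec power2_eq_square mult_ac)
  finally show ?thesis .
qed

text \<open>The plane of the last two eigenvectors meets the orthogonal complement of any vector
  \<open>w\<close> nontrivially, and on that plane the quotient is at most the larger of the two
  eigenvalues.\<close>

lemma exists_orthogonal_rayleigh_le_second_smallest:
  fixes A :: "real mat"
  assumes A: "A \<in> carrier_mat n n" and sym: "transpose_mat A = A" and n: "n = Suc (Suc k)"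
    and w: "w \<in> carrier_vec n"
  obtains x where "x \<in> carrier_vec n" "0 < x \<bullet> x" "x \<bullet> w = 0"
    "x \<bullet> (A *\<^sub>v x) \<le> eigenvalue_list A ! k * (x \<bullet> x)"
proof -
  let ?e = "\<lambda>i. eigenvalue_list A ! i"
  obtain P Q where "orthonormal_eigenbasis n A P Q"
    by (rule orthonormal_eigenbasis_exists[OF A sym])
  then interpret orthonormal_eigenbasis n A P Q .
  define z where "z = Q *\<^sub>v w"
  \<comment> \<open>A nontrivial solution of the single linear equation that expresses orthogonality
    to \<open>w\<close>.\<close>
  obtain a b where ab: "a \<noteq> 0 \<or> b \<noteq> 0" "a * z $ k + b * z $ Suc k = 0"
  proof (cases "z $ Suc k = 0")
    case True
    then show ?thesis using that[of 0 1] by simp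
  next
    case False
    then show ?thesis using that[of "z $ Suc k" "- z $ k"] by simp
  qed
  define y where "y = vec n (\<lambda>i. if i = k then a else if i = Suc k then b else 0)"
  define x where "x = P *\<^sub>v y"
  have y: "y \<in> carrier_vec n" unfolding y_def by simp
  have x: "x \<in> carrier_vec n" and Qx: "Q *\<^sub>v x = y" unfolding x_def using y P_carrier coords_inverse by auto
  have sum_y: "(\<Sum>i<n. y $ i * f i) = a * f k + b * f (Suc k)" for f
    unfolding n by (simp add: y_def n)
  have y_nth: "y $ k = a" "y $ Suc k = b" by (auto simp: y_def n)
  have xx: "x \<bullet> x = a\<^sup>2 + b\<^sup>2"
    by (simp add: scalar_prod_coords[OF x x] Qx sum_y y_nth power2_eq_square)
  have Ax: "x \<bullet> (A *\<^sub>v x) = ?e k * a\<^sup>2 + ?e (Suc k) * b\<^sup>2"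
  proof -
    have "x \<bullet> (A *\<^sub>v x) = (\<Sum>i<n. y $ i * (?e i * y $ i))"
      using A x by (simp add: scalar_prod_coords coords_mult_vec Qx)
    then show ?thesis by (simp add: sum_y y_nth power2_eq_square)
  qed
  have "?e (Suc k) \<le> ?e k"
    using n by (intro eigenvalue_list_antimono) (auto simp: length_eigenvalue_list[OF A sym])
  then have "?e (Suc k) * b\<^sup>2 \<le> ?e k * b\<^sup>2" by (rule mult_right_mono) simp
  then have "x \<bullet> (A *\<^sub>v x) \<le> ?e k * (x \<bullet> x)" unfolding Ax xx by (simp add: algebra_simps)
  moreover have "0 < x \<bullet> x" using ab(1) unfolding xx by (simp add: sum_power2_gt_zero_iff)
  moreover have "x \<bullet> w = 0" using ab(2) by (simp add: scalar_prod_coords[OF x w] Qx sum_y z_def)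
  ultimately show ?thesis using that x by blast
qed

subsection \<open>The integrated Laplacian\<close>

text \<open>The diagonal of \<open>L\<close> turns each row of the product into weighted differences
  of entries of \<open>x\<close>. The sum runs over ordered pairs, which explains the factor
  2.\<close>

lemma laplacian_quadratic_form:
  fixes A L :: "real mat"
  assumes A: "A \<in> carrier_mat m m" and sym: "transpose_mat A = A"
    and L: "L = mat m m (\<lambda>(i, j). if i = j then \<Sum>k<m. A $$ (i, k) else 0) - A"
    and x: "x \<in> carrier_vec m"
  shows "2 * (x \<bullet> (L *\<^sub>v x)) = (\<Sum>i<m. \<Sum>j<m. A $$ (i, j) * (x $ i - x $ j)\<^sup>2)"
proof -
  have Lc: "L \<in> carrier_mat m m" unfolding L by (rule minus_carrier_mat[OF A])
  have Lx: "(L *\<^sub>v x) $ i = (\<Sum>j<m. A $$ (i, j) * (x $ i - x $ j))" if i: "i < m" for i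
  proof -
    have "(L *\<^sub>v x) $ i =
        (\<Sum>j<m. (if i = j then (\<Sum>k<m. A $$ (i, k)) * x $ j else 0) - A $$ (i, j) * x $ j)"
      unfolding mult_mat_vec_index_sum[OF Lc x i]
      by (rule sum.cong) (use A i in \<open>auto simp: L algebra_simps\<close>)
    then show ?thesis
      using i by (simp add: sum_subtractf right_diff_distrib sum_distrib_right)
  qed
  have "x \<bullet> (L *\<^sub>v x) = (\<Sum>i<m. x $ i * (L *\<^sub>v x) $ i)"
    using Lc by (simp add: scalar_prod_def lessThan_atLeast0)
  also have "\<dots> = (\<Sum>i<m. \<Sum>j<m. A $$ (i, j) * (x $ i * (x $ i - x $ j)))" (is "_ = ?S")
    by (simp add: Lx sum_distrib_left mult_ac)
  finally have S: "x \<bullet> (L *\<^sub>v x) = ?S" .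
  have A_comm: "A $$ (i, j) = A $$ (j, i)" if "i < m" "j < m" for i j
    using sym A that by (metis carrier_matD index_transpose_mat(1))
  \<comment> \<open>Swapping the sums and using the symmetry of \<open>A\<close> exchanges
    \<open>i\<close> and \<open>j\<close> in the factors from \<open>x\<close>. Adding the two forms
    of \<open>?S\<close> completes the square.\<close>
  have "?S = (\<Sum>j<m. \<Sum>i<m. A $$ (i, j) * (x $ i * (x $ i - x $ j)))"
    by (rule sum.swap)
  also have "\<dots> = (\<Sum>i<m. \<Sum>j<m. A $$ (i, j) * (x $ j * (x $ j - x $ i)))"
    by (intro sum.cong) (auto simp: A_comm)
  finally have "2 * ?S = ?S + (\<Sum>i<m. \<Sum>j<m. A $$ (i, j) * (x $ j * (x $ j - x $ i)))"
    by simp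
  also have "\<dots> = (\<Sum>i<m. \<Sum>j<m. A $$ (i, j) * (x $ i - x $ j)\<^sup>2)"
    unfolding sum.distrib[symmetric]
    by (intro sum.cong) (auto simp: algebra_simps power2_eq_square)
  finally show ?thesis unfolding S .
qed

section \<open>Degrees as row sums of the integrated adjacency matrix\<close>

lemma size_incident_edges:
  assumes "finite V" and "\<forall>e \<in># E. set_uprod e \<subseteq> V"
  shows "size {#e \<in># E. v \<in> set_uprod e#} = (\<Sum>w\<in>V. count E (Upair v w))"
  using assms(2)
proof (induction E)
  case (add e E)
  \<comment> \<open>A new edge at \<open>v\<close> raises exactly one summand, the one at its other
    end; a loop raises only the summand at \<open>v\<close>, so it counts once on both
    sides.\<close>
  have "(\<Sum>w\<in>V. if Upair v w = e then 1 else 0) = (if v \<in> set_uprod e then 1 else (0::nat))"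
  proof (cases "v \<in> set_uprod e")
    case True
    then obtain u where u: "e = Upair v u"
      by (cases e) (auto simp: Upair_inject)
    then have "u \<in> V" using add.prems by auto
    moreover have "(Upair v w = e) = (w = u)" for w using u by auto
    ultimately show ?thesis using True assms(1) by simp
  next
    case False
    then have "Upair v w \<noteq> e" for w by auto
    then show ?thesis using False by simp
  qed
  moreover have "(\<Sum>w\<in>V. count (add_mset e E) (Upair v w)) =
      (\<Sum>w\<in>V. if Upair v w = e then 1 else 0) + (\<Sum>w\<in>V. count E (Upair v w))"
    unfolding sum.distrib[symmetric] by (rule sum.cong) auto
  ultimately show ?case using add by simp
qed simp

lemma size_outgoing_arcs:
  assumes "finite V" and "set_mset E \<subseteq> V \<times> V"
  shows "size {#a \<in># E. fst a = v#} = (\<Sum>w\<in>V. count E (v, w))"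
  using assms(2)
proof (induction E)
  case (add a E)
  have "(\<Sum>w\<in>V. if (v, w) = a then 1 else 0) = (if fst a = v then 1 else (0::nat))"
  proof -
    have "((v, w) = a) = (fst a = v \<and> w = snd a)" for w by auto
    moreover have "snd a \<in> V" using add.prems by auto
    ultimately show ?thesis using assms(1) by simp
  qed
  moreover have "(\<Sum>w\<in>V. count (add_mset a E) (v, w)) =
      (\<Sum>w\<in>V. if (v, w) = a then 1 else 0) + (\<Sum>w\<in>V. count E (v, w))"
    unfolding sum.distrib[symmetric] by (rule sum.cong) auto
  ultimately show ?case using add by simp
qed simp

lemma size_incoming_arcs:
  assumes "finite V" and "set_mset E \<subseteq> V \<times> V"
  shows "size {#a \<in># E. snd a = v#} = (\<Sum>w\<in>V. count E (w, v))"
  using assms(2)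
proof (induction E)
  case (add a E)
  have "(\<Sum>w\<in>V. if (w, v) = a then 1 else 0) = (if snd a = v then 1 else (0::nat))"
  proof -
    have "((w, v) = a) = (snd a = v \<and> w = fst a)" for w by auto
    moreover have "fst a \<in> V" using add.prems by auto
    ultimately show ?thesis using assms(1) by simp
  qed
  moreover have "(\<Sum>w\<in>V. count (add_mset a E) (w, v)) =
      (\<Sum>w\<in>V. if (w, v) = a then 1 else 0) + (\<Sum>w\<in>V. count E (w, v))"
    unfolding sum.distrib[symmetric] by (rule sum.cong) auto
  ultimately show ?case using add by simp
qed simp

lemma sum_lessThan_add:
  fixes f :: "nat \<Rightarrow> 'a :: comm_monoid_add"
  shows "sum f {..<n + k} = sum f {..<n} + (\<Sum>j<k. f (n + j))"
  by (induction k) (simp_all add: add.assoc)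

lemma sum_nth_distinct:
  assumes "distinct vs"
  shows "(\<Sum>i<length vs. f (vs ! i)) = sum f (set vs)"
  using bij_betw_nth[OF assms refl refl] by (rule sum.reindex_bij_betw)

lemma integrated_adjacency_carrier:
  "integrated_adjacency vs H \<in> carrier_mat (2 * length vs) (2 * length vs)"
  by (simp add: integrated_adjacency_def Let_def)

lemma integrated_adjacency_index:
  assumes "i < length vs" "j < length vs"
  shows "integrated_adjacency vs H $$ (i, j) = real (count (edges H) (Upair (vs ! i) (vs ! j)))"
    and "integrated_adjacency vs H $$ (i, length vs + j) = real (count (arcs H) (vs ! i, vs ! j))"
    and "integrated_adjacency vs H $$ (length vs + i, j) = real (count (arcs H) (vs ! j, vs ! i))"
    and "integrated_adjacency vs H $$ (length vs + i, length vs + j) =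
      real (count (edges H) (Upair (vs ! i) (vs ! j)))"
  using assms by (simp_all add: integrated_adjacency_def Let_def)

text \<open>The edge blocks are symmetric because edges are unordered, and the two arc blocks are
  transposes of each other.\<close>

lemma transpose_integrated_adjacency:
  "transpose_mat (integrated_adjacency vs H) = integrated_adjacency vs H"
proof (rule eq_matI)
  have comm: "count (edges H) (Upair u v) = count (edges H) (Upair v u)" for u v
    by (rule arg_cong[where f = "count (edges H)"]) simp
  have block: "k < length vs \<or> (\<exists>k'<length vs. k = length vs + k')" if "k < 2 * length vs" for k
  proof (cases "k < length vs")
    case False
    then show ?thesis using that by (intro disjI2 exI[of _ "k - length vs"]) auto
  qed simp
  fix i j
  assume "i < dim_row (integrated_adjacency vs H)" "j < dim_col (integrated_adjacency vs H)"
  then have i: "i < 2 * length vs" and j: "j < 2 * length vs"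
    using integrated_adjacency_carrier[of vs H] by auto
  have "integrated_adjacency vs H $$ (j, i) = integrated_adjacency vs H $$ (i, j)"
    using block[OF i] block[OF j] by (elim disjE exE conjE) (simp_all add: integrated_adjacency_index comm)
  then show "transpose_mat (integrated_adjacency vs H) $$ (i, j) = integrated_adjacency vs H $$ (i, j)"
    using i j integrated_adjacency_carrier[of vs H] by simp
qed (use integrated_adjacency_carrier[of vs H] in auto)

lemma integrated_adjacency_nonneg:
  assumes "i < 2 * length vs" "j < 2 * length vs"
  shows "0 \<le> integrated_adjacency vs H $$ (i, j)"
  using assms by (simp add: integrated_adjacency_def Let_def)

text \<open>A primed row collects edges and outgoing arcs, a double-primed row edges and incoming
  arcs. The integrated Laplacian is thus the usual Laplacian of a weighted graph on the
  \<open>2 * length vs\<close> vertex copies.\<close>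

lemma sum_row_integrated_adjacency:
  assumes H: "mixed_graph H" and vs: "distinct vs" "set vs = verts H" and i: "i < 2 * length vs"
  shows "(\<Sum>j<2 * length vs. integrated_adjacency vs H $$ (i, j)) = integrated_degree vs H $$ (i, i)"
proof -
  let ?n = "length vs"
  have fin: "finite (verts H)" and E: "\<forall>e \<in># edges H. set_uprod e \<subseteq> verts H"
    and R: "set_mset (arcs H) \<subseteq> verts H \<times> verts H"
    using H by (auto simp: mixed_graph_def)
  have edges_sum: "(\<Sum>j<?n. real (count (edges H) (Upair v (vs ! j)))) = real (edge_degree H v)" for v
    unfolding edge_degree_def size_incident_edges[OF fin E]
    by (simp add: sum_nth_distinct[OF vs(1), of "\<lambda>w. real (count (edges H) (Upair v w))"] vs(2))
  have out_sum: "(\<Sum>j<?n. real (count (arcs H) (v, vs ! j))) = real (out_degree H v)" for v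
    unfolding out_degree_def size_outgoing_arcs[OF fin R]
    by (simp add: sum_nth_distinct[OF vs(1), of "\<lambda>w. real (count (arcs H) (v, w))"] vs(2))
  have in_sum: "(\<Sum>j<?n. real (count (arcs H) (vs ! j, v))) = real (in_degree H v)" for v
    unfolding in_degree_def size_incoming_arcs[OF fin R]
    by (simp add: sum_nth_distinct[OF vs(1), of "\<lambda>w. real (count (arcs H) (w, v))"] vs(2))
  have "(\<Sum>j<2 * ?n. integrated_adjacency vs H $$ (i, j)) =
      (\<Sum>j<?n. integrated_adjacency vs H $$ (i, j)) +
      (\<Sum>j<?n. integrated_adjacency vs H $$ (i, ?n + j))"
    unfolding mult_2 by (rule sum_lessThan_add)
  also have "\<dots> = integrated_degree vs H $$ (i, i)"
    using i by (simp add: integrated_adjacency_def integrated_degree_def Let_def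
      edges_sum out_sum in_sum)
  finally show ?thesis .
qed

section \<open>Symmetry, semidefiniteness and kernel of the integrated Laplacian\<close>

lemma integrated_laplacian_carrier:
  "integrated_laplacian vs H \<in> carrier_mat (2 * length vs) (2 * length vs)"
  unfolding integrated_laplacian_def by (rule minus_carrier_mat[OF integrated_adjacency_carrier])

lemma transpose_integrated_laplacian:
  "transpose_mat (integrated_laplacian vs H) = integrated_laplacian vs H"
proof -
  have "transpose_mat (integrated_degree vs H) = integrated_degree vs H"
    by (rule eq_matI) (auto simp: integrated_degree_def Let_def)
  moreover have "integrated_degree vs H \<in> carrier_mat (2 * length vs) (2 * length vs)"
    by (simp add: integrated_degree_def Let_def)
  ultimately show ?thesis
    unfolding integrated_laplacian_def
    by (simp add: transpose_minus[OF _ integrated_adjacency_carrier] transpose_integrated_adjacency)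
qed

lemma integrated_laplacian_row_sums:
  assumes "mixed_graph H" "distinct vs" "set vs = verts H"
  shows "integrated_laplacian vs H = mat (2 * length vs) (2 * length vs)
    (\<lambda>(i, j). if i = j then \<Sum>k<2 * length vs. integrated_adjacency vs H $$ (i, k) else 0)
    - integrated_adjacency vs H"
proof -
  have "integrated_degree vs H = mat (2 * length vs) (2 * length vs)
    (\<lambda>(i, j). if i = j then \<Sum>k<2 * length vs. integrated_adjacency vs H $$ (i, k) else 0)"
    by (rule eq_matI)
      (auto simp: sum_row_integrated_adjacency[OF assms], auto simp: integrated_degree_def Let_def)
  then show ?thesis by (simp add: integrated_laplacian_def)
qed

lemma integrated_laplacian_psd:
  assumes H: "mixed_graph H" "distinct vs" "set vs = verts H" and x: "x \<in> carrier_vec (2 * length vs)"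
  shows "0 \<le> x \<bullet> (integrated_laplacian vs H *\<^sub>v x)"
proof -
  have "0 \<le> 2 * (x \<bullet> (integrated_laplacian vs H *\<^sub>v x))"
    unfolding laplacian_quadratic_form[OF integrated_adjacency_carrier
        transpose_integrated_adjacency integrated_laplacian_row_sums[OF H] x]
    by (intro sum_nonneg mult_nonneg_nonneg integrated_adjacency_nonneg) auto
  then show ?thesis by simp
qed

lemma integrated_laplacian_kernel:
  assumes H: "mixed_graph H" "distinct vs" "set vs = verts H"
  shows "integrated_laplacian vs H *\<^sub>v vec (2 * length vs) (\<lambda>_. 1) = 0\<^sub>v (2 * length vs)"
proof (rule eq_vecI)
  let ?m = "2 * length vs"
  note A = integrated_adjacency_carrier[of vs H]
  fix i assume "i < dim_vec (0\<^sub>v ?m :: real vec)"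
  then have i: "i < ?m" by simp
  have "(integrated_laplacian vs H *\<^sub>v vec ?m (\<lambda>_. 1)) $ i =
      (\<Sum>j<?m. (if i = j then \<Sum>k<?m. integrated_adjacency vs H $$ (i, k) else 0)
        - integrated_adjacency vs H $$ (i, j))"
    unfolding mult_mat_vec_index_sum[OF integrated_laplacian_carrier vec_carrier i]
    by (rule sum.cong) (use i A in \<open>auto simp: integrated_laplacian_row_sums[OF H]\<close>)
  also have "\<dots> = 0" using i by (simp add: sum_subtractf)
  finally show "(integrated_laplacian vs H *\<^sub>v vec ?m (\<lambda>_. 1)) $ i = 0\<^sub>v ?m $ i" using i by simp
qed (use integrated_laplacian_carrier[of vs H] in auto)

section \<open>Additivity over factorizations and the eigenvalue inequalities\<close>

lemma disjoint_union_mset_eq_add: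
  assumes "A \<inter># B = {#}"
  shows "A \<union># B = A + B"
  using assms by (simp add: union_diff_inter_eq_sup[symmetric])

text \<open>Multiset union takes the maximum of multiplicities, which is the sum for disjoint
  multisets. Counts and degrees, hence all matrix entries, then add up.\<close>

lemma integrated_laplacian_factorization:
  assumes "factorization G G1 G2"
  shows "integrated_laplacian vs G = integrated_laplacian vs G1 + integrated_laplacian vs G2"
proof -
  have "edges G = edges G1 + edges G2" "arcs G = arcs G1 + arcs G2"
    using assms by (auto simp: factorization_def disjoint_union_mset_eq_add)
  then show ?thesis
    by (intro eq_matI)
      (auto simp: integrated_laplacian_def integrated_degree_def integrated_adjacency_def Let_def
        edge_degree_def out_degree_def in_degree_def)
qed

theorem theorem3p12:
  fixes G G1 G2 :: "'a mixed_graph" and vs :: "'a list" and n :: nat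
  assumes "simple_mixed_graph G"
    and "factorization G G1 G2"
    and "distinct vs" and "set vs = verts G"
    and "n = card (verts G)" and "n \<ge> 1"
  shows "laplacian_ev vs (2 * n - 1) G \<ge>
           laplacian_ev vs (2 * n - 1) G1 + laplacian_ev vs (2 * n - 1) G2
    \<and> max (laplacian_ev vs 1 G1) (laplacian_ev vs 1 G2) \<le> laplacian_ev vs 1 G
    \<and> laplacian_ev vs 1 G \<le> laplacian_ev vs 1 G1 + laplacian_ev vs 1 G2"
proof -
  let ?L = "integrated_laplacian vs" and ?e = "\<lambda>H. eigenvalue_list (integrated_laplacian vs H)"
  define m where "m = 2 * length vs"
  \<comment> \<open>The position of eigenvalue number \<open>2 * n - 1\<close> in a list indexed
    from 0; \<open>n \<ge> 1\<close> keeps the subtraction from truncating.\<close>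
  define k where "k = 2 * n - 2"
  have "length vs = n" using assms(3-5) by (metis distinct_card)
  then have m: "m = Suc (Suc k)" and k: "2 * n - 1 - 1 = k"
    using assms(6) by (auto simp: m_def k_def)
  have G1: "mixed_graph G1" "distinct vs" "set vs = verts G1"
    and G2: "mixed_graph G2" "distinct vs" "set vs = verts G2"
    using assms(2-4) by (auto simp: factorization_def spanning_submixed_graph_def)
  note L = integrated_laplacian_carrier[of vs, folded m_def]
  note sym = transpose_integrated_laplacian[of vs]
  have split: "x \<bullet> (?L G *\<^sub>v x) = x \<bullet> (?L G1 *\<^sub>v x) + x \<bullet> (?L G2 *\<^sub>v x)"
    if x: "x \<in> carrier_vec m" for x
    using x L[of G1] L[of G2] unfolding integrated_laplacian_factorization[OF assms(2)]
    by (simp add: add_mult_distrib_mat_vec[of _ m m] scalar_prod_add_distrib[of _ m])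
  note psd1 = integrated_laplacian_psd[OF G1, folded m_def]
    and psd2 = integrated_laplacian_psd[OF G2, folded m_def]
  define w :: "real vec" where "w = vec m (\<lambda>_. 1)"
  have w: "w \<in> carrier_vec m" "w \<bullet> w \<noteq> 0" by (auto simp: w_def scalar_prod_def m)
  have ker: "?L G1 *\<^sub>v w = 0\<^sub>v m" "?L G2 *\<^sub>v w = 0\<^sub>v m"
    using integrated_laplacian_kernel[OF G1] integrated_laplacian_kernel[OF G2]
    by (simp_all add: w_def m_def)
  obtain x where x: "x \<in> carrier_vec m" "0 < x \<bullet> x" "x \<bullet> w = 0"
    "x \<bullet> (?L G *\<^sub>v x) \<le> ?e G ! k * (x \<bullet> x)"
    using exists_orthogonal_rayleigh_le_second_smallest[OF L sym m w(1)] by blast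
  \<comment> \<open>One vector \<open>x\<close> serves both factors, because the all-ones vector
    \<open>w\<close> lies in both kernels.\<close>
  have "(?e G1 ! k + ?e G2 ! k) * (x \<bullet> x) \<le> ?e G ! k * (x \<bullet> x)"
    using second_smallest_eigenvalue_le_rayleigh[OF L sym m psd1 w ker(1) x(1,3)]
      second_smallest_eigenvalue_le_rayleigh[OF L sym m psd2 w ker(2) x(1,3)] x(4)
    by (simp add: split[OF x(1)] distrib_right)
  then have second: "?e G1 ! k + ?e G2 ! k \<le> ?e G ! k" using x(2) by simp
  have m0: "0 < m" by (simp add: m)
  \<comment> \<open>The form of \<open>G\<close> is tested at a top eigenvector of \<open>H\<close>.
    For \<open>H\<close> equal to \<open>G1\<close> or \<open>G2\<close>, the premise holds because
    the form of the other factor is nonnegative.\<close>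
  have sub: "?e H ! 0 \<le> ?e G ! 0"
    if le: "\<And>x. x \<in> carrier_vec m \<Longrightarrow> x \<bullet> (?L H *\<^sub>v x) \<le> x \<bullet> (?L G *\<^sub>v x)" for H
  proof -
    obtain y where "y \<in> carrier_vec m" "y \<bullet> y = 1" "y \<bullet> (?L H *\<^sub>v y) = ?e H ! 0"
      using largest_eigenvalue_attained[OF L sym m0] by blast
    then show ?thesis using rayleigh_le_largest_eigenvalue[OF L sym, of y G] le[of y] by simp
  qed
  have "?e G1 ! 0 \<le> ?e G ! 0" "?e G2 ! 0 \<le> ?e G ! 0"
    by (auto intro!: sub simp: split psd1 psd2)
  moreover have "?e G ! 0 \<le> ?e G1 ! 0 + ?e G2 ! 0"
  proof -
    \<comment> \<open>At a top eigenvector of \<open>G\<close>, the forms of \<open>G1\<close> and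
      \<open>G2\<close> are bounded separately.\<close>
    obtain y where "y \<in> carrier_vec m" "y \<bullet> y = 1" "y \<bullet> (?L G *\<^sub>v y) = ?e G ! 0"
      using largest_eigenvalue_attained[OF L sym m0] by blast
    then show ?thesis
      using rayleigh_le_largest_eigenvalue[OF L sym, of y G1]
        rayleigh_le_largest_eigenvalue[OF L sym, of y G2] split[of y] by simp
  qed
  ultimately show ?thesis using second unfolding laplacian_ev_def k by simp
qed

end
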